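(* Let $r$ be a positive integer and let $m$ be an even positive integer. Put $Y=\{1,\dots,r\}$, $X_i=\{(i,\ell,x)\mid \ell\in\mathbb{Z}_m,\ x\in Y\}$ for $i\in\mathbb{Z}_m$, and $X=X_0\cup\cdots\cup X_{m-1}$ (so $|X|=m^2r$). Let $u$ be a complex number with $(u^2+u^{-2})^2=r$ if $r\ge 2$ and $u^4=1$ if $r=1$, let $A_u=u^3I-u^{-1}(J-I)\in\mathrm{Mat}_Y(\mathbb{C})$ be the Potts model ($I$ the identity, $J$ the all-ones matrix), and let $H\in\mathrm{Mat}_Y(\mathbb{C})$ be a Hadamard matrix of order $r$. For $i,j\in\mathbb{Z}_m$ define $V_{ij}=A_u$ if $i-j$ is even, $V_{ij}=H$ if $(i,j)\equiv(0,1)\pmod 2$, and $V_{ij}=H^T$ if $(i,j)\equiv(1,0)\pmod 2$. Identify $\mathbb{Z}_m$ with $\{0,1,\dots,m-1\}\subset\mathbb{Z}$. Then: (i) Let $a$ be a primitive $2m^2$-th root of unity and put $\epsilon(i,j)=(i-j)^2+m(i-j)$. Let $W\in\mathrm{Mat}_X(\mathbb{C})$ have entries $W(\alpha,\beta)=a^{2m(\ell-\ell')(i-j)+\epsilon(i,j)}V_{ij}(x,y)$ for $\alpha=(i,\ell,x)$, $\beta=(j,\ell',y)\in X$. Then $W$ is a spin model of index $m$. (ii) Let $\eta$ be a primitive $m$-th root of unity, let $b$ be an $m^2$-th root of unity, and put $\delta(i,j)=(i-j)^2$. Let $W'\in\mathrm{Mat}_X(\mathbb{C})$ have entries $W'(\alpha,\beta)=\eta^{(\ell-\ell')(i-j)}b^{\delta(i,j)}V_{ij}(x,y)$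 for $\alpha=(i,\ell,x)$, $\beta=(j,\ell',y)\in X$. Then $W'$ is a symmetric spin model.
   Context: For a finite set $X$ with $n=|X|$, a matrix $W$ with rows and columns indexed by $X$ and all entries nonzero complex numbers is a type II matrix if $\sum_{x\in X}W(\alpha,x)/W(\beta,x)=n\delta_{\alpha,\beta}$ for all $\alpha,\beta\in X$. A type II matrix $W$ is a spin model if there is a nonzero real number $D$ with $D^2=n$ such that $\sum_{x\in X}\frac{W(\alpha,x)W(\beta,x)}{W(\gamma,x)}=D\frac{W(\alpha,\beta)}{W(\alpha,\gamma)W(\gamma,\beta)}$ for all $\alpha,\beta,\gamma\in X$. For a spin model $W$, $W^TW^{-1}$ is a permutation matrix, and its order (as a permutation) is called the index of $W$. A Hadamard matrix of order $r$ is an $r\times r$ matrix $H$ with entries $\pm1$ satisfying $HH^T=rI$. *)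

theory Defs
  imports Complex_Main "HOL-Combinatorics.Permutations"
begin

text \<open>A complex matrix with rows and columns indexed by a finite set \<open>X\<close> is a function
  \<open>W :: 'a \<Rightarrow> 'a \<Rightarrow> complex\<close> together with the carrier \<open>X :: 'a set\<close>; only the values on
  \<open>X \<times> X\<close> matter.\<close>

definition mat_id :: "'a \<Rightarrow> 'a \<Rightarrow> complex" where
  "mat_id \<alpha> \<beta> = (if \<alpha> = \<beta> then 1 else 0)"

definition mat_transpose :: "('a \<Rightarrow> 'a \<Rightarrow> complex) \<Rightarrow> 'a \<Rightarrow> 'a \<Rightarrow> complex" where
  "mat_transpose W \<alpha> \<beta> = W \<beta> \<alpha>"

definition mat_times ::
    "'a set \<Rightarrow> ('a \<Rightarrow> 'a \<Rightarrow> complex) \<Rightarrow> ('a \<Rightarrow> 'a \<Rightarrow> complex) \<Rightarrow> 'a \<Rightarrow> 'a \<Rightarrow> complex" where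
  "mat_times X A B \<alpha> \<beta> = (\<Sum>x\<in>X. A \<alpha> x * B x \<beta>)"

definition mat_eq :: "'a set \<Rightarrow> ('a \<Rightarrow> 'a \<Rightarrow> complex) \<Rightarrow> ('a \<Rightarrow> 'a \<Rightarrow> complex) \<Rightarrow> bool" where
  "mat_eq X A B \<longleftrightarrow> (\<forall>\<alpha>\<in>X. \<forall>\<beta>\<in>X. A \<alpha> \<beta> = B \<alpha> \<beta>)"

definition is_mat_inverse ::
    "'a set \<Rightarrow> ('a \<Rightarrow> 'a \<Rightarrow> complex) \<Rightarrow> ('a \<Rightarrow> 'a \<Rightarrow> complex) \<Rightarrow> bool" where
  "is_mat_inverse X W V \<longleftrightarrow>
     mat_eq X (mat_times X W V) mat_id \<and> mat_eq X (mat_times X V W) mat_id"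

definition symmetric_matrix :: "'a set \<Rightarrow> ('a \<Rightarrow> 'a \<Rightarrow> complex) \<Rightarrow> bool" where
  "symmetric_matrix X W \<longleftrightarrow> mat_eq X (mat_transpose W) W"

definition type_II :: "'a set \<Rightarrow> ('a \<Rightarrow> 'a \<Rightarrow> complex) \<Rightarrow> bool" where
  "type_II X W \<longleftrightarrow>
     finite X \<and> (\<forall>\<alpha>\<in>X. \<forall>\<beta>\<in>X. W \<alpha> \<beta> \<noteq> 0) \<and>
     (\<forall>\<alpha>\<in>X. \<forall>\<beta>\<in>X. (\<Sum>x\<in>X. W \<alpha> x / W \<beta> x) = of_nat (card X) * mat_id \<alpha> \<beta>)"

definition spin_model :: "'a set \<Rightarrow> ('a \<Rightarrow> 'a \<Rightarrow> complex) \<Rightarrow> bool" where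
  "spin_model X W \<longleftrightarrow>
     type_II X W \<and>
     (\<exists>D::real. D \<noteq> 0 \<and> D ^ 2 = real (card X) \<and>
        (\<forall>\<alpha>\<in>X. \<forall>\<beta>\<in>X. \<forall>\<gamma>\<in>X.
           (\<Sum>x\<in>X. W \<alpha> x * W \<beta> x / W \<gamma> x)
             = complex_of_real D * (W \<alpha> \<beta> / (W \<alpha> \<gamma> * W \<gamma> \<beta>))))"

definition perm_mat :: "('a \<Rightarrow> 'a) \<Rightarrow> 'a \<Rightarrow> 'a \<Rightarrow> complex" where
  "perm_mat \<sigma> \<alpha> \<beta> = (if \<beta> = \<sigma> \<alpha> then 1 else 0)"

definition perm_order :: "('a \<Rightarrow> 'a) \<Rightarrow> nat" where
  "perm_order \<sigma> = (LEAST k. 0 < k \<and> \<sigma> ^^ k = id)"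

text \<open>The index is a relation rather than a function, so that \<open>has_index X W k\<close> includes the
  assertions that \<open>W\<close> is invertible and that \<open>W\<^sup>T W\<^sup>-\<^sup>1\<close> is a permutation matrix. The value \<open>k\<close> is
  unique, and since \<open>\<sigma>\<close> permutes a finite set the minimum in \<open>perm_order\<close> is attained.\<close>

definition has_index :: "'a set \<Rightarrow> ('a \<Rightarrow> 'a \<Rightarrow> complex) \<Rightarrow> nat \<Rightarrow> bool" where
  "has_index X W k \<longleftrightarrow>
     finite X \<and>
     (\<exists>V \<sigma>. is_mat_inverse X W V \<and> \<sigma> permutes X \<and>
        mat_eq X (mat_times X (mat_transpose W) V) (perm_mat \<sigma>) \<and> perm_order \<sigma> = k)"

definition primitive_root_of_unity :: "nat \<Rightarrow> complex \<Rightarrow> bool" where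
  "primitive_root_of_unity n z \<longleftrightarrow> 0 < n \<and> z ^ n = 1 \<and> (\<forall>k. 0 < k \<and> k < n \<longrightarrow> z ^ k \<noteq> 1)"

definition hadamard_matrix :: "nat \<Rightarrow> (nat \<Rightarrow> nat \<Rightarrow> complex) \<Rightarrow> bool" where
  "hadamard_matrix r H \<longleftrightarrow>
     (\<forall>x\<in>{1..r}. \<forall>y\<in>{1..r}. H x y = 1 \<or> H x y = -1) \<and>
     mat_eq {1..r} (mat_times {1..r} H (mat_transpose H)) (\<lambda>x y. of_nat r * mat_id x y)"

definition potts :: "complex \<Rightarrow> nat \<Rightarrow> nat \<Rightarrow> complex" where
  "potts u x y = u ^ 3 * mat_id x y - inverse u * (1 - mat_id x y)"

text \<open>\<open>\<int>\<^sub>m\<close> is represented by the integers \<open>0, \<dots>, m - 1\<close>, so differences of indices below are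
  genuine integers (possibly negative) and powers use integer exponents.\<close>

definition index_set :: "nat \<Rightarrow> nat \<Rightarrow> (int \<times> int \<times> nat) set" where
  "index_set m r = {0..<int m} \<times> {0..<int m} \<times> {1..r}"

definition V_block ::
    "complex \<Rightarrow> (nat \<Rightarrow> nat \<Rightarrow> complex) \<Rightarrow> int \<Rightarrow> int \<Rightarrow> nat \<Rightarrow> nat \<Rightarrow> complex" where
  "V_block u H i j =
     (if even (i - j) then potts u
      else if even i \<and> odd j then H
      else mat_transpose H)"

definition W_nonsym ::
    "nat \<Rightarrow> complex \<Rightarrow> (nat \<Rightarrow> nat \<Rightarrow> complex) \<Rightarrow> complex
       \<Rightarrow> int \<times> int \<times> nat \<Rightarrow> int \<times> int \<times> nat \<Rightarrow> complex" where
  "W_nonsym m u H a = (\<lambda>(i, l, x) (j, l', y).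
     a powi (2 * int m * (l - l') * (i - j) + ((i - j) ^ 2 + int m * (i - j))) * V_block u H i j x y)"

definition W_sym ::
    "complex \<Rightarrow> (nat \<Rightarrow> nat \<Rightarrow> complex) \<Rightarrow> complex \<Rightarrow> complex
       \<Rightarrow> int \<times> int \<times> nat \<Rightarrow> int \<times> int \<times> nat \<Rightarrow> complex" where
  "W_sym u H \<eta> b = (\<lambda>(i, l, x) (j, l', y).
     \<eta> powi ((l - l') * (i - j)) * b powi ((i - j) ^ 2) * V_block u H i j x y)"

end

theory Submission
  imports Defs "Jordan_Normal_Form.Determinant"
begin

text \<open>Summing over the level \<open>l\<close> first is a character sum over the cyclic group of order \<open>m\<close>. In the
  star-triangle sum for \<open>\<alpha>, \<beta>, \<gamma>\<close> with block indices \<open>i1, i2, i3\<close> it kills every block \<open>j\<close> except the one with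
  \<open>j \<equiv> i1 + i2 - i3 (mod m)\<close>. For this \<open>j\<close> the roots of unity on the two sides agree, because
  \<open>p\<^sup>2 + q\<^sup>2 - (p + q)\<^sup>2 = (p - q)\<^sup>2 - p\<^sup>2 - q\<^sup>2\<close> for \<open>p = i3 - i2\<close>, \<open>q = i3 - i1\<close>, and what remains is an identity for the \<open>r \<times> r\<close> blocks.
  As \<open>m\<close> is even, \<open>j \<equiv> i1 + i2 + i3 (mod 2)\<close>, so these blocks are either all Potts matrices, or two of
  the three factors come from the same Hadamard matrix, whose rows are orthogonal.

  Transposing the matrix in (i) changes an entry in block \<open>(i, j)\<close> by \<open>a\<^bsup>- 2 m (i - j)\<^esup>\<close>, which is what
  lowering the level of the row index by one does; so \<open>W\<^sup>T W\<^sup>-\<^sup>1\<close> is a cyclic shift of order \<open>m\<close>.\<close>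

section \<open>Roots of unity with integer exponents and character sums\<close>

lemma primitive_root_powi_eq_1_iff:
  assumes "primitive_root_of_unity n z"
  shows "z powi k = 1 \<longleftrightarrow> int n dvd k"
proof -
  have n: "0 < n" "z ^ n = 1" and prim: "\<And>k. 0 < k \<Longrightarrow> k < n \<Longrightarrow> z ^ k \<noteq> 1"
    using assms by (auto simp: primitive_root_of_unity_def)
  have z: "z \<noteq> 0" using n by (auto simp: power_0_left)
  have per: "z powi (int n * q) = 1" for q
    using n by (simp add: power_int_mult)
  \<comment> \<open>Primitivity speaks only of natural exponents below \<open>n\<close>, so a
    possibly negative \<open>k\<close> is first reduced modulo \<open>n\<close>.\<close>
  have red: "z powi k = z ^ nat (k mod int n)"
  proof -
    have "z powi k = z powi (int n * (k div int n) + k mod int n)" by simp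
    also have "\<dots> = z powi (k mod int n)"
      by (subst power_int_add) (use z per in auto)
    also have "\<dots> = z ^ nat (k mod int n)"
      using n by (simp add: power_int_def)
    finally show ?thesis .
  qed
  have lt: "nat (k mod int n) < n"
    using n by (simp add: nat_less_iff)
  show ?thesis
  proof
    assume "z powi k = 1"
    then have "nat (k mod int n) = 0"
      using red prim[OF _ lt] by (metis gr0I)
    then show "int n dvd k"
      using n by (simp add: dvd_eq_mod_eq_0 nat_eq_iff)
  next
    assume "int n dvd k" then show "z powi k = 1" using per by auto
  qed
qed

text \<open>Orthogonality of characters: a geometric sum whose ratio \<open>z powi k\<close> has
  \<open>n\<close>-th power 1.\<close>

lemma sum_primitive_root_powi:
  assumes "primitive_root_of_unity n z"
  shows "(\<Sum>l\<in>{0..<int n}. z powi (k * l)) = (if int n dvd k then of_nat n else 0)"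
proof -
  define w where "w = z powi k"
  have w1: "w = 1 \<longleftrightarrow> int n dvd k"
    using primitive_root_powi_eq_1_iff[OF assms] by (simp add: w_def)
  have "w ^ n = z powi (k * int n)"
    by (simp add: w_def power_int_mult)
  then have wn: "w ^ n = 1"
    using primitive_root_powi_eq_1_iff[OF assms] by simp
  have "(\<Sum>l\<in>{0..<int n}. z powi (k * l)) = (\<Sum>l\<in>int ` {0..<n}. w powi l)"
    by (simp add: w_def power_int_mult image_int_atLeastLessThan)
  also have "\<dots> = (\<Sum>l<n. w ^ l)"
    by (subst sum.reindex) (auto simp: lessThan_atLeast0)
  finally show ?thesis
    using w1 wn by (simp add: sum_gp_strict)
qed

lemma powi_cong_primitive_root:
  assumes "primitive_root_of_unity n z" "int n dvd k - l"
  shows "z powi k = z powi l"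
proof -
  have "z \<noteq> 0" using assms(1) by (auto simp: primitive_root_of_unity_def power_0_left)
  then have "z powi k = z powi (k - l) * z powi l"
    by (metis diff_add_cancel power_int_add)
  then show ?thesis
    using primitive_root_powi_eq_1_iff[OF assms(1)] assms(2) by simp
qed

section \<open>Twisted block matrices: reduction to the blocks\<close>

text \<open>The common shape of the two matrices: only the twist by \<open>\<omega>\<close> sees the
  levels, and \<open>c\<close> collects the root of unity that depends on the blocks alone. In (i)
  \<open>\<omega>\<close> is \<open>a ^ (2 * m)\<close>, in (ii) it is
  \<open>\<eta>\<close>.\<close>

definition W_twist ::
    "complex \<Rightarrow> (int \<Rightarrow> int \<Rightarrow> complex) \<Rightarrow> (int \<Rightarrow> int \<Rightarrow> nat \<Rightarrow> nat \<Rightarrow> complex)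
       \<Rightarrow> int \<times> int \<times> nat \<Rightarrow> int \<times> int \<times> nat \<Rightarrow> complex" where
  "W_twist \<omega> c V = (\<lambda>(i, l, x) (j, l', y). \<omega> powi ((l - l') * (i - j)) * c i j * V i j x y)"

lemma finite_index_set: "finite (index_set m r)"
  and card_index_set: "card (index_set m r) = m * m * r"
  by (simp_all add: index_set_def card_cartesian_product)

lemma sum_index_set:
  "sum f (index_set m r) = (\<Sum>j\<in>{0..<int m}. \<Sum>l\<in>{0..<int m}. \<Sum>y\<in>{1..r}. f (j, l, y))"
  by (simp add: index_set_def sum.cartesian_product case_prod_beta)

lemma index_eqI:
  assumes "i \<in> {0..<int m}" "j \<in> {0..<int m}" "int m dvd i - j"
  shows "i = j"
  using assms by (metis atLeastLessThan_iff mod_eq_dvd_iff mod_pos_pos_trivial)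

lemma W_twist_nonzero:
  assumes "primitive_root_of_unity m \<omega>" "\<And>i j. c i j \<noteq> 0"
    and "\<And>i j x y. x \<in> {1..r} \<Longrightarrow> y \<in> {1..r} \<Longrightarrow> V i j x y \<noteq> 0"
    and "\<alpha> \<in> index_set m r" "\<beta> \<in> index_set m r"
  shows "W_twist \<omega> c V \<alpha> \<beta> \<noteq> 0"
proof -
  have "\<omega> \<noteq> 0" using assms(1) by (auto simp: primitive_root_of_unity_def power_0_left)
  then show ?thesis
    using assms by (auto simp: W_twist_def index_set_def power_int_not_zero)
qed

text \<open>The sum over the level \<open>l\<close> vanishes unless both rows lie in the same block
  row. Then the factors \<open>c\<close> cancel, the sum over \<open>y\<close> compares
  \<open>x\<close> with \<open>x'\<close>, and what is left is a character sum over the blocks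
  \<open>j\<close>, which compares the levels \<open>k\<close> and \<open>k'\<close>.\<close>

lemma type_II_W_twist:
  assumes \<omega>: "primitive_root_of_unity m \<omega>" and c: "\<And>i j. c i j \<noteq> 0"
    and V0: "\<And>i j x y. x \<in> {1..r} \<Longrightarrow> y \<in> {1..r} \<Longrightarrow> V i j x y \<noteq> 0"
    and V: "\<And>i j x x'. x \<in> {1..r} \<Longrightarrow> x' \<in> {1..r} \<Longrightarrow>
      (\<Sum>y\<in>{1..r}. V i j x y / V i j x' y) = of_nat r * mat_id x x'"
  shows "type_II (index_set m r) (W_twist \<omega> c V)"
  unfolding type_II_def
proof (intro conjI ballI)
  show "finite (index_set m r)" by (rule finite_index_set)
next
  fix \<alpha> \<beta> assume "\<alpha> \<in> index_set m r" "\<beta> \<in> index_set m r"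
  then show "W_twist \<omega> c V \<alpha> \<beta> \<noteq> 0"
    using W_twist_nonzero[of m \<omega> c r V \<alpha> \<beta>] \<omega> c V0 by blast
next
  fix \<alpha> \<beta> assume ab: "\<alpha> \<in> index_set m r" "\<beta> \<in> index_set m r"
  obtain i k x where a: "\<alpha> = (i, k, x)" by (cases \<alpha>)
  obtain i' k' x' where b: "\<beta> = (i', k', x')" by (cases \<beta>)
  have I: "i \<in> {0..<int m}" "i' \<in> {0..<int m}" "k \<in> {0..<int m}" "k' \<in> {0..<int m}"
    "x \<in> {1..r}" "x' \<in> {1..r}"
    using ab by (auto simp: a b index_set_def)
  have w0: "\<omega> \<noteq> 0" using \<omega> by (auto simp: primitive_root_of_unity_def power_0_left)
  \<comment> \<open>\<open>T j\<close> is the contribution of block \<open>j\<close> once the only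
    factor depending on \<open>l\<close> has been split off.\<close>
  define T where "T j = \<omega> powi (k * (i - j) - k' * (i' - j)) * (c i j / c i' j) *
      (\<Sum>y\<in>{1..r}. V i j x y / V i' j x' y)" for j
  have summand: "W_twist \<omega> c V \<alpha> (j, l, y) / W_twist \<omega> c V \<beta> (j, l, y) =
      \<omega> powi ((i' - i) * l) * (\<omega> powi (k * (i - j) - k' * (i' - j)) * (c i j / c i' j) *
      (V i j x y / V i' j x' y))" for j l y
  proof -
    have "\<omega> powi ((k - l) * (i - j)) / \<omega> powi ((k' - l) * (i' - j))
      = \<omega> powi ((k - l) * (i - j) - (k' - l) * (i' - j))"
      using w0 by (simp add: power_int_diff)
    also have "(k - l) * (i - j) - (k' - l) * (i' - j) =
        (i' - i) * l + (k * (i - j) - k' * (i' - j))" by (simp add: algebra_simps)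
    also have "\<omega> powi \<dots> = \<omega> powi ((i' - i) * l) * \<omega> powi (k * (i - j) - k' * (i' - j))"
      using w0 by (subst power_int_add) auto
    finally have exps: "\<omega> powi ((k - l) * (i - j)) / \<omega> powi ((k' - l) * (i' - j)) =
        \<omega> powi ((i' - i) * l) * \<omega> powi (k * (i - j) - k' * (i' - j))" .
    have "W_twist \<omega> c V \<alpha> (j, l, y) / W_twist \<omega> c V \<beta> (j, l, y) =
        (\<omega> powi ((k - l) * (i - j)) / \<omega> powi ((k' - l) * (i' - j))) *
        ((c i j / c i' j) * (V i j x y / V i' j x' y))"
      by (simp add: W_twist_def a b mult_ac)
    then show ?thesis by (simp only: exps mult.assoc)
  qed
  have "(\<Sum>z\<in>index_set m r. W_twist \<omega> c V \<alpha> z / W_twist \<omega> c V \<beta> z) =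
      (\<Sum>j\<in>{0..<int m}. (\<Sum>l\<in>{0..<int m}. \<omega> powi ((i' - i) * l)) * T j)"
    unfolding sum_index_set summand T_def sum_distrib_left[symmetric] sum_distrib_right[symmetric] ..
  also have "\<dots> = (if int m dvd i' - i then of_nat m else 0) * sum T {0..<int m}"
    by (simp only: sum_primitive_root_powi[OF \<omega>] sum_distrib_left)
  also have "\<dots> = of_nat (card (index_set m r)) * mat_id \<alpha> \<beta>"
  proof (cases "i = i'")
    case False
    then have "\<not> int m dvd i' - i" using index_eqI I by metis
    then show ?thesis using False by (simp add: mat_id_def a b)
  next
    case True
    have T_eq: "T j = \<omega> powi ((k - k') * i) * of_nat r * mat_id x x' * \<omega> powi ((k' - k) * j)" for j
    proof -
      have "k * (i - j) - k' * (i - j) = (k - k') * i + (k' - k) * j" by (simp add: algebra_simps)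
      then have "\<omega> powi (k * (i - j) - k' * (i - j)) =
          \<omega> powi ((k - k') * i) * \<omega> powi ((k' - k) * j)"
        using w0 power_int_add[of \<omega>] by metis
      then show ?thesis
        using c V[OF I(5,6)] by (simp add: T_def True)
    qed
    have "sum T {0..<int m} = (\<Sum>j\<in>{0..<int m}.
        \<omega> powi ((k - k') * i) * of_nat r * mat_id x x' * \<omega> powi ((k' - k) * j))"
      by (rule sum.cong) (simp_all only: T_eq)
    also have "\<dots> = \<omega> powi ((k - k') * i) * of_nat r * mat_id x x' *
        (if int m dvd k' - k then of_nat m else 0)"
      by (simp only: sum_primitive_root_powi[OF \<omega>] sum_distrib_left[symmetric])
    finally have "sum T {0..<int m} = \<omega> powi ((k - k') * i) * of_nat r * mat_id x x' *
        (if int m dvd k' - k then of_nat m else 0)" .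
    moreover have "int m dvd k' - k \<longleftrightarrow> k = k'" using index_eqI I by auto
    ultimately show ?thesis
      by (simp add: card_index_set True mat_id_def a b)
  qed
  finally show "(\<Sum>z\<in>index_set m r. W_twist \<omega> c V \<alpha> z / W_twist \<omega> c V \<beta> z) =
    of_nat (card (index_set m r)) * mat_id \<alpha> \<beta>" .
qed

text \<open>Splits the star-triangle identity into one for the scalars \<open>c\<close> and one for
  the blocks. Both are stated for all integers \<open>j\<close> in a congruence class because
  \<open>i1 + i2 - i3\<close> itself may fall outside \<open>0, ..., m - 1\<close>.\<close>

lemma spin_model_W_twist:
  assumes \<omega>: "primitive_root_of_unity m \<omega>" and c: "\<And>i j. c i j \<noteq> 0"
    and V0: "\<And>i j x y. x \<in> {1..r} \<Longrightarrow> y \<in> {1..r} \<Longrightarrow> V i j x y \<noteq> 0"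
    and II: "type_II (index_set m r) (W_twist \<omega> c V)"
    and D: "D \<noteq> 0" "D ^ 2 = real r"
    and c_star: "\<And>i1 i2 i3 j. int m dvd j - (i1 + i2 - i3) \<Longrightarrow>
      c i1 j * c i2 j * c i1 i3 * c i3 i2 = c i3 j * c i1 i2"
    and V_star: "\<And>i1 i2 i3 j x1 x2 x3. int m dvd j - (i1 + i2 - i3) \<Longrightarrow>
      x1 \<in> {1..r} \<Longrightarrow> x2 \<in> {1..r} \<Longrightarrow> x3 \<in> {1..r} \<Longrightarrow>
      (\<Sum>y\<in>{1..r}. V i1 j x1 y * V i2 j x2 y / V i3 j x3 y) =
        complex_of_real D * (V i1 i2 x1 x2 / (V i1 i3 x1 x3 * V i3 i2 x3 x2))"
  shows "spin_model (index_set m r) (W_twist \<omega> c V)"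
  unfolding spin_model_def
\<comment> \<open>The factor \<open>m\<close> is the value of the level sum on the one surviving
  block.\<close>
proof (intro conjI exI[of _ "real m * D"] ballI)
  have m: "0 < m" using \<omega> by (simp add: primitive_root_of_unity_def)
  have w0: "\<omega> \<noteq> 0" using \<omega> by (auto simp: primitive_root_of_unity_def power_0_left)
  show "type_II (index_set m r) (W_twist \<omega> c V)" by (rule II)
  show "real m * D \<noteq> 0" using m D by simp
  show "(real m * D)\<^sup>2 = real (card (index_set m r))"
    using D by (simp add: card_index_set power2_eq_square algebra_simps)
  fix \<alpha> \<beta> \<gamma> assume abc: "\<alpha> \<in> index_set m r" "\<beta> \<in> index_set m r" "\<gamma> \<in> index_set m r"
  obtain i1 k1 x1 where a: "\<alpha> = (i1, k1, x1)" by (cases \<alpha>)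
  obtain i2 k2 x2 where b: "\<beta> = (i2, k2, x2)" by (cases \<beta>)
  obtain i3 k3 x3 where g: "\<gamma> = (i3, k3, x3)" by (cases \<gamma>)
  have I: "x1 \<in> {1..r}" "x2 \<in> {1..r}" "x3 \<in> {1..r}"
    using abc by (auto simp: a b g index_set_def)
  let ?E = "\<lambda>j. k1 * (i1 - j) + k2 * (i2 - j) - k3 * (i3 - j)"
  let ?F = "(k1 - k2) * (i1 - i2) - (k1 - k3) * (i1 - i3) - (k3 - k2) * (i3 - i2)"
  define s where "s = (i1 + i2 - i3) mod int m"
  have s: "s \<in> {0..<int m}" using m by (simp add: s_def)
  have sd: "int m dvd s - (i1 + i2 - i3)" by (simp add: s_def mod_eq_dvd_iff[symmetric])
  have sd_iff: "int m dvd j - (i1 + i2 - i3) \<longleftrightarrow> j = s" if "j \<in> {0..<int m}" for j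
    using that by (auto simp: s_def mod_eq_dvd_iff[symmetric])
  define T where "T j = \<omega> powi ?E j * (c i1 j * c i2 j / c i3 j) *
      (\<Sum>y\<in>{1..r}. V i1 j x1 y * V i2 j x2 y / V i3 j x3 y)" for j
  have summand: "W_twist \<omega> c V \<alpha> (j, l, y) * W_twist \<omega> c V \<beta> (j, l, y) / W_twist \<omega> c V \<gamma> (j, l, y) =
      \<omega> powi ((j - (i1 + i2 - i3)) * l) * (\<omega> powi ?E j * (c i1 j * c i2 j / c i3 j) *
      (V i1 j x1 y * V i2 j x2 y / V i3 j x3 y))" for j l y
  proof -
    have "\<omega> powi ((k1 - l) * (i1 - j)) * \<omega> powi ((k2 - l) * (i2 - j)) / \<omega> powi ((k3 - l) * (i3 - j))
      = \<omega> powi ((k1 - l) * (i1 - j) + (k2 - l) * (i2 - j) - (k3 - l) * (i3 - j))"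
      using w0 by (simp add: power_int_diff power_int_add)
    also have "(k1 - l) * (i1 - j) + (k2 - l) * (i2 - j) - (k3 - l) * (i3 - j) =
        (j - (i1 + i2 - i3)) * l + ?E j" by (simp add: algebra_simps)
    also have "\<omega> powi \<dots> = \<omega> powi ((j - (i1 + i2 - i3)) * l) * \<omega> powi ?E j"
      using w0 by (subst power_int_add) auto
    finally have exps: "\<omega> powi ((k1 - l) * (i1 - j)) * \<omega> powi ((k2 - l) * (i2 - j)) /
        \<omega> powi ((k3 - l) * (i3 - j)) = \<omega> powi ((j - (i1 + i2 - i3)) * l) * \<omega> powi ?E j" .
    have "W_twist \<omega> c V \<alpha> (j, l, y) * W_twist \<omega> c V \<beta> (j, l, y) / W_twist \<omega> c V \<gamma> (j, l, y) =
        (\<omega> powi ((k1 - l) * (i1 - j)) * \<omega> powi ((k2 - l) * (i2 - j)) / \<omega> powi ((k3 - l) * (i3 - j))) *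
        ((c i1 j * c i2 j / c i3 j) * (V i1 j x1 y * V i2 j x2 y / V i3 j x3 y))"
      by (simp add: W_twist_def a b g mult_ac)
    then show ?thesis by (simp only: exps mult.assoc)
  qed
  have "(\<Sum>z\<in>index_set m r. W_twist \<omega> c V \<alpha> z * W_twist \<omega> c V \<beta> z / W_twist \<omega> c V \<gamma> z) =
      (\<Sum>j\<in>{0..<int m}. (\<Sum>l\<in>{0..<int m}. \<omega> powi ((j - (i1 + i2 - i3)) * l)) * T j)"
    unfolding sum_index_set summand T_def sum_distrib_left[symmetric] sum_distrib_right[symmetric] ..
  also have "\<dots> = (\<Sum>j\<in>{0..<int m}. if j = s then of_nat m * T j else 0)"
    by (rule sum.cong) (auto simp: sum_primitive_root_powi[OF \<omega>] sd_iff sd)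
  also have "\<dots> = of_nat m * T s"
    using s by simp
  also have "T s = \<omega> powi ?F * (c i1 i2 / (c i1 i3 * c i3 i2)) *
      (complex_of_real D * (V i1 i2 x1 x2 / (V i1 i3 x1 x3 * V i3 i2 x3 x2)))"
  proof -
    \<comment> \<open>The two exponents of \<open>\<omega>\<close> are not equal, only congruent
      modulo \<open>m\<close>, by the choice of \<open>s\<close>.\<close>
    have "?E s - ?F = (s - (i1 + i2 - i3)) * (k3 - k1 - k2)" by (simp add: algebra_simps)
    then have "\<omega> powi ?E s = \<omega> powi ?F"
      using sd by (intro powi_cong_primitive_root[OF \<omega>]) simp
    moreover have "c i1 s * c i2 s / c i3 s = c i1 i2 / (c i1 i3 * c i3 i2)"
      using c_star[OF sd] c by (simp add: frac_eq_eq mult.assoc mult.commute mult.left_commute)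
    ultimately show ?thesis
      by (simp only: T_def V_star[OF sd I])
  qed
  also have "of_nat m * \<dots> = complex_of_real (real m * D) *
      (W_twist \<omega> c V \<alpha> \<beta> / (W_twist \<omega> c V \<alpha> \<gamma> * W_twist \<omega> c V \<gamma> \<beta>))"
    using w0 by (simp add: W_twist_def a b g power_int_diff mult_ac)
  finally show "(\<Sum>z\<in>index_set m r. W_twist \<omega> c V \<alpha> z * W_twist \<omega> c V \<beta> z / W_twist \<omega> c V \<gamma> z) =
    complex_of_real (real m * D) *
      (W_twist \<omega> c V \<alpha> \<beta> / (W_twist \<omega> c V \<alpha> \<gamma> * W_twist \<omega> c V \<gamma> \<beta>))" .
qed

section \<open>Hadamard matrices\<close>

lemma hadamard_row_sum:
  assumes "hadamard_matrix r H" "x \<in> {1..r}" "x' \<in> {1..r}"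
  shows "(\<Sum>y\<in>{1..r}. H x y * H x' y) = of_nat r * mat_id x x'"
  using assms by (auto simp: hadamard_matrix_def mat_eq_def mat_times_def mat_transpose_def)

text \<open>Row orthogonality says that H^T / r is a right inverse of H. A right inverse of a square
  matrix is also a left inverse, which is column orthogonality.\<close>

lemma hadamard_matrix_transpose:
  assumes H: "hadamard_matrix r H"
  shows "hadamard_matrix r (mat_transpose H)"
proof (cases "r = 0")
  case True
  then show ?thesis by (simp add: hadamard_matrix_def mat_eq_def)
next
  case r: False
  \<comment> \<open>\<open>Suc\<close> translates the indices \<open>{1..r}\<close> of
    \<open>H\<close> to the 0-based indices of \<open>mat\<close>.\<close>
  define A where "A = mat r r (\<lambda>(i, j). H (Suc i) (Suc j))"
  define B where "B = mat r r (\<lambda>(i, j). H (Suc j) (Suc i) / of_nat r)"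
  have AB: "A \<in> carrier_mat r r" "B \<in> carrier_mat r r"
    by (auto simp: A_def B_def)
  have reindex: "(\<Sum>k = 0..<r. f (Suc k)) = sum f {1..r}" for f :: "nat \<Rightarrow> complex"
    by (metis One_nat_def sum.shift_bounds_Suc_ivl atLeastLessThanSuc_atLeastAtMost)
  have "A * B = 1\<^sub>m r"
  proof (rule eq_matI)
    fix i j assume ij: "i < dim_row (1\<^sub>m r :: complex mat)" "j < dim_col (1\<^sub>m r :: complex mat)"
    then have "(A * B) $$ (i, j) = (\<Sum>k=0..<r. H (Suc i) (Suc k) * H (Suc j) (Suc k) / of_nat r)"
      by (simp add: A_def B_def scalar_prod_def)
    also have "\<dots> = (\<Sum>k\<in>{1..r}. H (Suc i) k * H (Suc j) k) / of_nat r"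
      by (subst reindex) (simp add: sum_divide_distrib)
    also have "\<dots> = 1\<^sub>m r $$ (i, j)"
      using ij r by (subst hadamard_row_sum[OF H]) (auto simp: mat_id_def)
    finally show "(A * B) $$ (i, j) = 1\<^sub>m r $$ (i, j)" .
  qed (use AB in auto)
  then have BA: "B * A = 1\<^sub>m r"
    by (rule mat_mult_left_right_inverse[OF AB])
  have "(\<Sum>k\<in>{1..r}. H k x * H k y) = of_nat r * mat_id x y"
    if xy: "x \<in> {1..r}" "y \<in> {1..r}" for x y
  proof -
    obtain i j where ij: "x = Suc i" "y = Suc j" "i < r" "j < r"
      using xy by (cases x; cases y) auto
    have "(\<Sum>k\<in>{1..r}. H k x * H k y) / of_nat r
        = (\<Sum>k=0..<r. H (Suc k) x * H (Suc k) y / of_nat r)"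
      by (subst reindex) (simp add: sum_divide_distrib)
    also have "\<dots> = (B * A) $$ (i, j)"
      using ij by (simp add: A_def B_def scalar_prod_def)
    also have "\<dots> = mat_id x y"
      using ij by (simp add: BA mat_id_def)
    finally show ?thesis using r by (simp add: field_simps)
  qed
  then show ?thesis
    using H by (auto simp: hadamard_matrix_def mat_eq_def mat_times_def mat_transpose_def)
qed

lemma hadamard_entry:
  assumes "hadamard_matrix r H" "x \<in> {1..r}" "y \<in> {1..r}"
  shows "H x y * H x y = 1" "H x y \<noteq> 0" "inverse (H x y) = H x y"
proof -
  have "H x y = 1 \<or> H x y = -1"
    using assms by (simp add: hadamard_matrix_def)
  then show "H x y * H x y = 1" "H x y \<noteq> 0" "inverse (H x y) = H x y" by auto
qed

section \<open>The Potts model\<close>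

text \<open>Made for rows of Potts matrices, which are constant off the diagonal, so that
  \<open>S\<close> has at most three points. The cardinalities are subtracted in the complex numbers
  to avoid truncation.\<close>

lemma sum_const_off:
  fixes f :: "'a \<Rightarrow> complex"
  assumes "finite A" "S \<subseteq> A" and "\<And>y. y \<in> A - S \<Longrightarrow> f y = c"
  shows "sum f A = sum f S + (of_nat (card A) - of_nat (card S)) * c"
proof -
  have "sum f A = sum f S + sum f (A - S)"
    using assms(1,2) by (simp add: sum.subset_diff)
  also have "sum f (A - S) = of_nat (card (A - S)) * c"
    using assms(3) by simp
  also have "card (A - S) = card A - card S"
    using assms(1,2) by (simp add: card_Diff_subset finite_subset)
  also have "of_nat (card A - card S) = (of_nat (card A) - of_nat (card S) :: complex)"
    using card_mono[OF assms(1,2)] by (simp add: of_nat_diff)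
  finally show ?thesis .
qed

text \<open>\<open>D\<close> is the constant of the Potts model, hence \<open>m * D\<close> that of the composite models. For \<open>r = 1\<close>
  the formula valid for \<open>r \<ge> 2\<close> would give \<open>- 2 u\<^sup>2\<close>, so that case is separate.\<close>

locale potts_parameters =
  fixes r :: nat and u D :: complex
  assumes r_pos: "0 < r" and u_nz: "u \<noteq> 0" and D_sq: "D ^ 2 = of_nat r"
    and D_eq: "2 \<le> r \<Longrightarrow> D = - (u ^ 2 + inverse (u ^ 2))"
    and D_eq_1: "r = 1 \<Longrightarrow> D = u ^ 2" and u_eq_1: "r = 1 \<Longrightarrow> u ^ 4 = 1"
begin

text \<open>A spin model requires a real constant; a complex square root of \<open>r\<close> is one
  of the two real roots.\<close>

lemma D_real:
  obtains d :: real where "D = complex_of_real d" "d \<noteq> 0" "d ^ 2 = real r"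
proof -
  have "D ^ 2 = (complex_of_real (sqrt (real r))) ^ 2"
    using D_sq by (simp flip: of_real_power)
  then consider "D = complex_of_real (sqrt (real r))" | "D = complex_of_real (- sqrt (real r))"
    by (auto simp: power2_eq_iff)
  then show thesis
    using that[of "sqrt (real r)"] that[of "- sqrt (real r)"] r_pos by cases auto
qed

lemma potts_nz: "potts u x y \<noteq> 0"
  using u_nz by (auto simp: potts_def mat_id_def)

lemma potts_commute: "potts u x y = potts u y x"
  by (auto simp: potts_def mat_id_def)

lemma potts_eq: "potts u x x = u ^ 3"
  and potts_neq: "x \<noteq> y \<Longrightarrow> potts u x y = - inverse u"
  by (auto simp: potts_def mat_id_def)

lemma r_ge_2: "x \<in> {1..r} \<Longrightarrow> y \<in> {1..r} \<Longrightarrow> x \<noteq> y \<Longrightarrow> 2 \<le> r"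
  by auto

text \<open>Eliminates \<open>r\<close>, so that the identities below become identities between
  Laurent polynomials in \<open>u\<close>.\<close>

lemma r_eq: "2 \<le> r \<Longrightarrow> of_nat r = u ^ 4 + 2 + inverse u ^ 4"
  using D_sq D_eq u_nz by (auto simp: power2_eq_square field_simps power4_eq_xxxx)

lemma u_pow_1:
  assumes "r = 1"
  shows "inverse u = u ^ 3"
  using u_eq_1[OF assms] u_nz by (simp add: field_simps power4_eq_xxxx power3_eq_cube)

text \<open>For distinct rows, \<open>y = x\<close> and \<open>y = x'\<close> contribute
  \<open>- (u ^ 4)\<close> and \<open>- (inverse u ^ 4)\<close>, and the other \<open>r - 2\<close>
  columns contribute 1 each.\<close>

lemma potts_type_II:
  assumes "x \<in> {1..r}" "x' \<in> {1..r}"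
  shows "(\<Sum>y\<in>{1..r}. potts u x y / potts u x' y) = of_nat r * mat_id x x'"
proof (cases "x = x'")
  case True
  then show ?thesis using potts_nz by (simp add: mat_id_def)
next
  case False
  have "(\<Sum>y\<in>{1..r}. potts u x y / potts u x' y) =
     (\<Sum>y\<in>{x, x'}. potts u x y / potts u x' y) + (of_nat (card {1..r}) - of_nat (card {x, x'})) * 1"
    using assms u_nz by (intro sum_const_off finite_atLeastAtMost) (auto simp: potts_neq)
  also have "\<dots> = 0"
    using False u_nz by (simp add: potts_eq potts_neq r_eq[OF r_ge_2[OF assms False]] power_numeral_reduce field_simps)
  finally show ?thesis using False by (simp add: mat_id_def)
qed

text \<open>Every \<open>y\<close> outside \<open>{x1, x2, x3}\<close> contributes
  \<open>- inverse u\<close>. The remaining terms depend only on which of the three points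
  coincide.\<close>

lemma potts_star:
  assumes I: "x1 \<in> {1..r}" "x2 \<in> {1..r}" "x3 \<in> {1..r}"
  shows "(\<Sum>y\<in>{1..r}. potts u x1 y * potts u x2 y / potts u x3 y) =
      D * (potts u x1 x2 / (potts u x1 x3 * potts u x3 x2))"
proof (cases "r = 1")
  case True
  then have x: "x1 = 1" "x2 = 1" "x3 = 1" using I by auto
  \<comment> \<open>With a single point the claim reads \<open>p = D * (p / (p * p))\<close>, so
    \<open>D\<close> has to be \<open>u ^ 6\<close>, which is \<open>u ^ 2\<close> because
    \<open>u ^ 4 = 1\<close>.\<close>
  define p where "p = u ^ 3"
  have "p * p = u ^ 4 * u ^ 2" by (simp add: p_def flip: power_add)
  then have "D = p * p"
    by (simp add: u_eq_1[OF True] D_eq_1[OF True])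
  moreover have "p \<noteq> 0" using u_nz by (simp add: p_def)
  moreover have "potts u 1 1 = p" by (simp add: potts_eq p_def)
  ultimately show ?thesis
    unfolding x by (simp add: True del: One_nat_def)
next
  case False
  then have r2: "2 \<le> r" using r_pos by simp
  let ?S = "{x1, x2, x3}"
  have "(\<Sum>y\<in>{1..r}. potts u x1 y * potts u x2 y / potts u x3 y) =
     (\<Sum>y\<in>?S. potts u x1 y * potts u x2 y / potts u x3 y) +
     (of_nat (card {1..r}) - of_nat (card ?S)) * (- inverse u)"
    using I u_nz by (intro sum_const_off finite_atLeastAtMost) (auto simp: potts_neq)
  also have "\<dots> = D * (potts u x1 x2 / (potts u x1 x3 * potts u x3 x2))"
  proof -
    consider "x1 = x2" "x1 = x3"
      | "x1 = x2" "x1 \<noteq> x3"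
      | "x1 = x3" "x1 \<noteq> x2"
      | "x2 = x3" "x1 \<noteq> x2"
      | "x1 \<noteq> x2" "x1 \<noteq> x3" "x2 \<noteq> x3"
      by blast
    then show ?thesis
    proof cases
      case 1
      then have S: "?S = {x1}" by auto
      show ?thesis
        using 1 u_nz unfolding S card_atLeastAtMost diff_Suc_1 D_eq[OF r2] r_eq[OF r2]
        by (simp add: potts_eq potts_neq power_numeral_reduce field_simps)
    next
      case 2
      then have S: "?S = {x1, x3}" by auto
      show ?thesis
        using 2 u_nz unfolding S card_atLeastAtMost diff_Suc_1 D_eq[OF r2] r_eq[OF r2]
        by (simp add: potts_eq potts_neq power_numeral_reduce field_simps)
    next
      case 3
      then have S: "?S = {x1, x2}" by auto
      show ?thesis
        using 3 u_nz unfolding S card_atLeastAtMost diff_Suc_1 D_eq[OF r2] r_eq[OF r2]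
        by (simp add: potts_eq potts_neq power_numeral_reduce field_simps)
    next
      case 4
      then have S: "?S = {x1, x2}" by auto
      show ?thesis
        using 4 u_nz unfolding S card_atLeastAtMost diff_Suc_1 D_eq[OF r2] r_eq[OF r2]
        by (simp add: potts_eq potts_neq power_numeral_reduce field_simps)
    next
      case 5
      then show ?thesis
        using u_nz unfolding card_atLeastAtMost diff_Suc_1 D_eq[OF r2] r_eq[OF r2]
        by (simp add: potts_eq potts_neq power_numeral_reduce field_simps)
    qed
  qed
  finally show ?thesis .
qed

section \<open>Products of Hadamard rows against Potts rows\<close>

text \<open>\<open>f\<close> is the constant \<open>c\<close> plus a spike at \<open>x3\<close>: row
  orthogonality evaluates the constant part, and the spike leaves one term.\<close>

lemma hadamard_sum_two_valued:
  assumes H: "hadamard_matrix r H" and I: "x1 \<in> {1..r}" "x2 \<in> {1..r}" "x3 \<in> {1..r}"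
    and f: "\<And>y. y \<noteq> x3 \<Longrightarrow> f y = c"
  shows "(\<Sum>y\<in>{1..r}. H x1 y * H x2 y * f y) =
      c * of_nat r * mat_id x1 x2 + (f x3 - c) * H x1 x3 * H x2 x3"
proof -
  have "H x1 y * H x2 y * f y =
      c * (H x1 y * H x2 y) + (if y = x3 then (f x3 - c) * H x1 x3 * H x2 x3 else 0)" for y
    using f[of y] by (auto simp: algebra_simps)
  then have "(\<Sum>y\<in>{1..r}. H x1 y * H x2 y * f y) =
      c * (\<Sum>y\<in>{1..r}. H x1 y * H x2 y) + (f x3 - c) * H x1 x3 * H x2 x3"
    using I by (simp add: sum.distrib sum_distrib_left)
  then show ?thesis
    by (simp only: hadamard_row_sum[OF H I(1,2)] mult.assoc)
qed

text \<open>The entrywise product of two rows of \<open>H\<close> is the all-ones vector or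
  orthogonal to it, hence an eigenvector of the entrywise inverse of the Potts matrix. The
  eigenvalue is \<open>D * potts u x1 x2\<close>.\<close>

lemma hadamard_sum_inverse_potts:
  assumes H: "hadamard_matrix r H" and I: "x1 \<in> {1..r}" "x2 \<in> {1..r}" "x3 \<in> {1..r}"
  shows "(\<Sum>y\<in>{1..r}. H x1 y * H x2 y / potts u x3 y) =
      D * potts u x1 x2 * (H x1 x3 * H x2 x3)"
proof -
  have "(\<Sum>y\<in>{1..r}. H x1 y * H x2 y / potts u x3 y) =
      - u * of_nat r * mat_id x1 x2 + (inverse u ^ 3 + u) * (H x1 x3 * H x2 x3)"
    using hadamard_sum_two_valued[OF H I, of "\<lambda>y. inverse (potts u x3 y)" "- u"] u_nz
    by (simp add: potts_eq potts_neq divide_inverse power_inverse mult.assoc)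
  also have "\<dots> = D * potts u x1 x2 * (H x1 x3 * H x2 x3)"
  proof (cases "r = 1")
    case True
    then have "x1 = x2" using I by simp
    then show ?thesis
      using True hadamard_entry[OF H I(1,3)] D_eq_1[OF True] u_pow_1[OF True] u_eq_1[OF True]
      by (simp add: mat_id_def potts_eq power_numeral_reduce mult.assoc)
  next
    case False
    then have r2: "2 \<le> r" using r_pos by simp
    show ?thesis
    proof (cases "x1 = x2")
      case True
      then show ?thesis
        using u_nz hadamard_entry[OF H I(1,3)] unfolding D_eq[OF r2] r_eq[OF r2]
        by (simp add: mat_id_def potts_eq power_numeral_reduce field_simps)
    next
      case False
      then show ?thesis
        using u_nz unfolding D_eq[OF r2] r_eq[OF r2]
        by (simp add: mat_id_def potts_neq power_numeral_reduce field_simps)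
    qed
  qed
  finally show ?thesis .
qed

text \<open>The same eigenvectors for the Potts matrix itself, now with eigenvalue
  \<open>D / potts u x1 x2\<close>.\<close>

lemma hadamard_sum_potts:
  assumes H: "hadamard_matrix r H" and I: "x1 \<in> {1..r}" "x2 \<in> {1..r}" "x3 \<in> {1..r}"
  shows "(\<Sum>y\<in>{1..r}. H x1 y * H x2 y * potts u x3 y) =
      D / potts u x1 x2 * (H x1 x3 * H x2 x3)"
proof -
  have "(\<Sum>y\<in>{1..r}. H x1 y * H x2 y * potts u x3 y) =
      - inverse u * of_nat r * mat_id x1 x2 + (u ^ 3 + inverse u) * (H x1 x3 * H x2 x3)"
    using hadamard_sum_two_valued[OF H I, of "\<lambda>y. potts u x3 y" "- inverse u"]
    by (simp add: potts_eq potts_neq mult.assoc)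
  also have "\<dots> = D / potts u x1 x2 * (H x1 x3 * H x2 x3)"
  proof (cases "r = 1")
    case True
    then have "x1 = x2" using I by simp
    then show ?thesis
      using True u_nz hadamard_entry[OF H I(1,3)] D_eq_1[OF True] u_pow_1[OF True] u_eq_1[OF True]
      by (simp add: mat_id_def potts_eq power_numeral_reduce field_simps)
  next
    case False
    then have r2: "2 \<le> r" using r_pos by simp
    show ?thesis
    proof (cases "x1 = x2")
      case True
      then show ?thesis
        using u_nz hadamard_entry[OF H I(1,3)] unfolding D_eq[OF r2] r_eq[OF r2]
        by (simp add: mat_id_def potts_eq power_numeral_reduce field_simps)
    next
      case False
      then show ?thesis
        using u_nz unfolding D_eq[OF r2] r_eq[OF r2]
        by (simp add: mat_id_def potts_neq power_numeral_reduce field_simps)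
    qed
  qed
  finally show ?thesis .
qed

section \<open>Type II and star-triangle identities for the blocks\<close>

lemma V_block_nz:
  assumes "hadamard_matrix r H" "x \<in> {1..r}" "y \<in> {1..r}"
  shows "V_block u H i j x y \<noteq> 0"
  using assms hadamard_entry(2) potts_nz by (auto simp: V_block_def mat_transpose_def)

lemma V_block_type_II:
  assumes H: "hadamard_matrix r H" and I: "x \<in> {1..r}" "x' \<in> {1..r}"
  shows "(\<Sum>y\<in>{1..r}. V_block u H i j x y / V_block u H i j x' y) = of_nat r * mat_id x x'"
proof -
  have "(\<Sum>y\<in>{1..r}. K x y / K x' y) = of_nat r * mat_id x x'" if K: "hadamard_matrix r K" for K
  proof -
    have "(\<Sum>y\<in>{1..r}. K x y / K x' y) = (\<Sum>y\<in>{1..r}. K x y * K x' y)"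
      using hadamard_entry(3)[OF K I(2)] by (intro sum.cong) (auto simp: divide_inverse)
    then show ?thesis using hadamard_row_sum[OF K I] by simp
  qed
  then show ?thesis
    using potts_type_II[OF I] H hadamard_matrix_transpose[OF H] by (simp add: V_block_def)
qed

text \<open>Exchanging H and H^T amounts to exchanging the two parities; this halves the case
  distinction in the star-triangle identity.\<close>

lemma V_block_shift: "V_block u (mat_transpose H) i j = V_block u H (i + 1) (j + 1)"
  by (auto simp: V_block_def mat_transpose_def fun_eq_iff)

text \<open>Unless all blocks are Potts, two of the three factors are entries of the same Hadamard
  matrix. These are their own inverses, so each quotient becomes a product of two rows against a row
  of the Potts matrix or of its entrywise inverse.\<close>

lemma V_block_star_even:
  assumes H: "hadamard_matrix r H" and I: "x1 \<in> {1..r}" "x2 \<in> {1..r}" "x3 \<in> {1..r}"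
    and j: "even (j - (i1 + i2 - i3))" and i3: "even i3"
  shows "(\<Sum>y\<in>{1..r}. V_block u H i1 j x1 y * V_block u H i2 j x2 y / V_block u H i3 j x3 y) =
      D * (V_block u H i1 i2 x1 x2 / (V_block u H i1 i3 x1 x3 * V_block u H i3 i2 x3 x2))"
proof -
  note HT = hadamard_matrix_transpose[OF H]
  note inv = hadamard_entry(3)[OF H] hadamard_entry(3)[OF HT]
  consider "even i1" "even i2" "even j" | "even i1" "odd i2" "odd j"
    | "odd i1" "even i2" "odd j" | "odd i1" "odd i2" "even j"
    using j i3 by auto
  then show ?thesis
  proof cases
    case 1
    then show ?thesis using potts_star[OF I] i3 by (simp add: V_block_def)
  next
    case 2
    have "(\<Sum>y\<in>{1..r}. H x1 y * potts u x2 y / H x3 y) =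
        (\<Sum>y\<in>{1..r}. H x1 y * H x3 y * potts u x2 y)"
      using inv I by (intro sum.cong) (auto simp: divide_inverse)
    also have "\<dots> = D / potts u x1 x3 * (H x1 x2 * H x3 x2)"
      by (rule hadamard_sum_potts[OF H I(1,3,2)])
    also have "\<dots> = D * (H x1 x2 / (potts u x1 x3 * H x3 x2))"
      using inv I by (simp add: divide_inverse)
    finally show ?thesis using 2 i3 by (simp add: V_block_def)
  next
    case 3
    have "(\<Sum>y\<in>{1..r}. potts u x1 y * H x2 y / H x3 y) =
        (\<Sum>y\<in>{1..r}. H x2 y * H x3 y * potts u x1 y)"
      using inv I by (intro sum.cong) (auto simp: divide_inverse)
    also have "\<dots> = D / potts u x2 x3 * (H x2 x1 * H x3 x1)"
      by (rule hadamard_sum_potts[OF H I(2,3,1)])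
    also have "\<dots> = D * (H x2 x1 / (H x3 x1 * potts u x3 x2))"
      using inv I potts_commute[of x2 x3] by (simp add: divide_inverse)
    finally show ?thesis using 3 i3 by (simp add: V_block_def mat_transpose_def)
  next
    case 4
    have "(\<Sum>y\<in>{1..r}. mat_transpose H x1 y * mat_transpose H x2 y / potts u x3 y) =
        D * potts u x1 x2 * (mat_transpose H x1 x3 * mat_transpose H x2 x3)"
      by (rule hadamard_sum_inverse_potts[OF HT I])
    also have "\<dots> = D * (potts u x1 x2 / (mat_transpose H x1 x3 * H x3 x2))"
      using inv I by (simp add: divide_inverse mat_transpose_def)
    finally show ?thesis using 4 i3 by (simp add: V_block_def)
  qed
qed

lemma V_block_star:
  assumes H: "hadamard_matrix r H" and I: "x1 \<in> {1..r}" "x2 \<in> {1..r}" "x3 \<in> {1..r}"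
    and j: "even (j - (i1 + i2 - i3))"
  shows "(\<Sum>y\<in>{1..r}. V_block u H i1 j x1 y * V_block u H i2 j x2 y / V_block u H i3 j x3 y) =
      D * (V_block u H i1 i2 x1 x2 / (V_block u H i1 i3 x1 x3 * V_block u H i3 i2 x3 x2))"
proof (cases "even i3")
  case True
  then show ?thesis by (rule V_block_star_even[OF H I j])
next
  case False
  \<comment> \<open>Lowering all four indices by one preserves the parity condition and makes the
    third index even.\<close>
  then have "even ((j - 1) - ((i1 - 1) + (i2 - 1) - (i3 - 1)))" "even (i3 - 1)"
    using j by auto
  from V_block_star_even[OF hadamard_matrix_transpose[OF H] I this] show ?thesis
    by (simp add: V_block_shift)
qed

end

lemma V_block_transpose: "V_block u H j i y x = V_block u H i j x y"
  by (auto simp: V_block_def mat_transpose_def potts_def mat_id_def)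

lemma primitive_root_of_unity_power:
  assumes "primitive_root_of_unity (k * n) z"
  shows "primitive_root_of_unity n (z ^ k)"
  using assms by (auto simp: primitive_root_of_unity_def power_mult[symmetric])

lemma powi_eq_1:
  fixes z :: complex
  assumes "z ^ n = 1" "int n dvd k"
  shows "z powi k = 1"
  using assms by (auto simp: power_int_mult)

section \<open>The index and the cyclic shift of the levels\<close>

text \<open>The inverse of a type II matrix is the transpose of its entrywise inverse divided by
  \<open>card X\<close>; type II for the transpose makes it a left inverse too. The last hypothesis
  says W^T = P W with P the matrix of \<open>\<sigma>\<close>, so W^T W^-1 = P.\<close>

lemma has_indexI:
  assumes II: "type_II X W" and IIT: "type_II X (mat_transpose W)"
    and \<sigma>: "\<sigma> permutes X" "perm_order \<sigma> = k"
    and W\<sigma>: "\<And>\<alpha> \<beta>. \<alpha> \<in> X \<Longrightarrow> \<beta> \<in> X \<Longrightarrow> W \<beta> \<alpha> = W (\<sigma> \<alpha>) \<beta>"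
  shows "has_index X W k"
proof -
  let ?n = "of_nat (card X) :: complex"
  define V where "V x \<beta> = 1 / (?n * W \<beta> x)" for x \<beta>
  have fin: "finite X" using II by (simp add: type_II_def)
  then have n: "?n \<noteq> 0" if "\<alpha> \<in> X" for \<alpha> using that by auto
  have rows: "(\<Sum>x\<in>X. W \<alpha> x * V x \<beta>) = mat_id \<alpha> \<beta>" if "\<alpha> \<in> X" "\<beta> \<in> X" for \<alpha> \<beta>
  proof -
    have "(\<Sum>x\<in>X. W \<alpha> x * V x \<beta>) = (\<Sum>x\<in>X. W \<alpha> x / W \<beta> x) / ?n"
      by (simp add: V_def sum_divide_distrib mult.commute)
    then show ?thesis using II that n by (simp add: type_II_def)
  qed
  have cols: "(\<Sum>x\<in>X. V \<alpha> x * W x \<beta>) = mat_id \<alpha> \<beta>" if "\<alpha> \<in> X" "\<beta> \<in> X" for \<alpha> \<beta>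
  proof -
    have "(\<Sum>x\<in>X. V \<alpha> x * W x \<beta>) = (\<Sum>x\<in>X. mat_transpose W \<beta> x / mat_transpose W \<alpha> x) / ?n"
      by (simp add: V_def mat_transpose_def sum_divide_distrib mult.commute)
    then show ?thesis using IIT that n by (simp add: type_II_def mat_id_def)
  qed
  have "(\<Sum>x\<in>X. W x \<alpha> * V x \<beta>) = perm_mat \<sigma> \<alpha> \<beta>" if "\<alpha> \<in> X" "\<beta> \<in> X" for \<alpha> \<beta>
  proof -
    have "(\<Sum>x\<in>X. W x \<alpha> * V x \<beta>) = (\<Sum>x\<in>X. W (\<sigma> \<alpha>) x * V x \<beta>)"
      using W\<sigma> that by (intro sum.cong) auto
    also have "\<dots> = mat_id (\<sigma> \<alpha>) \<beta>"
      using rows that permutes_in_image[OF \<sigma>(1)] by blast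
    finally show ?thesis by (simp add: perm_mat_def mat_id_def eq_commute)
  qed
  then show ?thesis
    unfolding has_index_def
    using fin \<sigma> rows cols
    by (intro conjI exI[of _ V] exI[of _ \<sigma>])
      (auto simp: is_mat_inverse_def mat_eq_def mat_times_def mat_transpose_def)
qed

text \<open>Extended by the identity outside the index set, as \<open>permutes\<close> demands and
  as \<open>perm_order\<close>, which compares with \<open>id\<close> on the whole type,
  requires.\<close>

definition level_shift :: "nat \<Rightarrow> nat \<Rightarrow> int \<times> int \<times> nat \<Rightarrow> int \<times> int \<times> nat" where
  "level_shift m r p =
     (if p \<in> index_set m r then (case p of (i, l, x) \<Rightarrow> (i, (l - 1) mod int m, x)) else p)"

lemma funpow_level_shift:
  assumes "(i, l, x) \<in> index_set m r"
  shows "(level_shift m r ^^ k) (i, l, x) = (i, (l - int k) mod int m, x)"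
proof (induction k)
  case 0
  then show ?case using assms by (auto simp: index_set_def)
next
  case (Suc k)
  have "(i, (l - int k) mod int m, x) \<in> index_set m r"
    using assms by (auto simp: index_set_def)
  then have "(level_shift m r ^^ Suc k) (i, l, x) = (i, ((l - int k) mod int m - 1) mod int m, x)"
    by (simp add: Suc.IH level_shift_def)
  also have "((l - int k) mod int m - 1) mod int m = (l - int (Suc k)) mod int m"
    by (simp add: mod_diff_left_eq algebra_simps)
  finally show ?case .
qed

lemma level_shift_order:
  "level_shift m r ^^ m = id"
proof
  fix p :: "int \<times> int \<times> nat"
  obtain i l x where p: "p = (i, l, x)" by (cases p)
  show "(level_shift m r ^^ m) p = id p"
  proof (cases "p \<in> index_set m r")
    case True
    then show ?thesis
      by (auto simp: p funpow_level_shift index_set_def)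
  next
    case False
    have "(level_shift m r ^^ k) p = p" for k
      by (induction k) (simp_all add: level_shift_def False)
    then show ?thesis by simp
  qed
qed

lemma level_shift_permutes: "level_shift m r permutes index_set m r"
proof (rule bij_imp_permutes)
  let ?s = "level_shift m r" and ?X = "index_set m r"
  have maps: "?s p \<in> ?X" if "p \<in> ?X" for p
    using that by (cases p) (auto simp: level_shift_def index_set_def)
  have "inj_on ?s ?X"
  proof (cases m)
    case 0
    then show ?thesis by (simp add: index_set_def)
  next
    case (Suc k)
    \<comment> \<open>Here \<open>k\<close> is \<open>m - 1\<close>, so this power is a left
      inverse; injectivity on a finite set then gives surjectivity.\<close>
    then have "(?s ^^ k) (?s p) = p" for p
      using fun_cong[OF level_shift_order[of m r], of p] by (simp add: funpow_swap1)
    then show ?thesis by (metis inj_onI)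
  qed
  then show "bij_betw ?s ?X ?X"
    using maps by (simp add: bij_betw_def endo_inj_surj finite_index_set image_subsetI)
qed (simp add: level_shift_def)

lemma perm_order_level_shift:
  assumes "0 < m" "0 < r"
  shows "perm_order (level_shift m r) = m"
  unfolding perm_order_def
proof (rule Least_equality)
  show "0 < m \<and> level_shift m r ^^ m = id"
    using assms level_shift_order by simp
next
  fix k assume k: "0 < k \<and> level_shift m r ^^ k = id"
  \<comment> \<open>The orbit of this one point already has length \<open>m\<close>.\<close>
  have "(0, 0, 1) \<in> index_set m r" using assms by (simp add: index_set_def)
  from funpow_level_shift[OF this, of k] k have "int m dvd int k"
    by (simp add: mod_eq_0_iff_dvd)
  then show "m \<le> k" using k by (auto dest: dvd_imp_le)
qed

section \<open>The two matrices as twisted block matrices\<close>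

text \<open>The twist exponent is a product of two differences, so both signs cancel, and the blocks
  are symmetric as a whole; only \<open>c\<close> notices the transposition.\<close>

lemma mat_transpose_W_twist:
  "mat_transpose (W_twist \<omega> c (V_block u H)) = W_twist \<omega> (\<lambda>i j. c j i) (V_block u H)"
proof (intro ext)
  fix \<alpha> \<beta> :: "int \<times> int \<times> nat"
  obtain i l x j l' y where p: "\<alpha> = (i, l, x)" "\<beta> = (j, l', y)"
    by (metis prod.exhaust)
  have exps: "(l' - l) * (j - i) = (l - l') * (i - j)"
    by (simp add: algebra_simps)
  show "mat_transpose (W_twist \<omega> c (V_block u H)) \<alpha> \<beta> =
      W_twist \<omega> (\<lambda>i j. c j i) (V_block u H) \<alpha> \<beta>"
    by (simp only: p mat_transpose_def W_twist_def prod.case exps V_block_transpose[of u H j i])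
qed

lemma W_sym_eq_W_twist:
  "W_sym u H \<eta> b = W_twist \<eta> (\<lambda>i j. b powi ((i - j) ^ 2)) (V_block u H)"
  by (simp add: W_sym_def W_twist_def)

lemma W_nonsym_eq_W_twist:
  assumes "a \<noteq> 0"
  shows "W_nonsym m u H a =
    W_twist (a ^ (2 * m)) (\<lambda>i j. a powi ((i - j) ^ 2 + int m * (i - j))) (V_block u H)"
proof -
  have "a powi (2 * int m * d * e + f) = (a ^ (2 * m)) powi (d * e) * a powi f" for d e f
  proof -
    have "(a ^ (2 * m)) powi (d * e) = a powi (int (2 * m) * (d * e))"
      by (simp only: power_int_mult power_int_of_nat)
    then show ?thesis using assms by (simp add: power_int_add mult.assoc)
  qed
  then show ?thesis by (simp add: W_nonsym_def W_twist_def)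
qed

lemma W_sym_star:
  fixes b :: complex
  assumes b: "b ^ (m ^ 2) = 1" "b \<noteq> 0" and j: "int m dvd j - (i1 + i2 - i3)"
  shows "b powi ((i1 - j) ^ 2) * b powi ((i2 - j) ^ 2) * b powi ((i1 - i3) ^ 2) * b powi ((i3 - i2) ^ 2) =
    b powi ((i3 - j) ^ 2) * b powi ((i1 - i2) ^ 2)"
proof -
  obtain k where "j - (i1 + i2 - i3) = int m * k" using j by blast
  then have jk: "j = i1 + i2 - i3 + int m * k" by simp
  \<comment> \<open>For \<open>k = 0\<close> this is the quadratic identity in \<open>p\<close> and
    \<open>q\<close>; passing to another \<open>j\<close> of the class costs a multiple of
    \<open>m ^ 2\<close>.\<close>
  have "(i1 - j) ^ 2 + (i2 - j) ^ 2 + (i1 - i3) ^ 2 + (i3 - i2) ^ 2 =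
      int (m ^ 2) * k ^ 2 + ((i3 - j) ^ 2 + (i1 - i2) ^ 2)"
    by (simp add: jk power2_eq_square algebra_simps)
  moreover have "b powi (int (m ^ 2) * k ^ 2) = 1"
    using b(1) by (rule powi_eq_1) simp
  ultimately have "b powi ((i1 - j) ^ 2 + (i2 - j) ^ 2 + (i1 - i3) ^ 2 + (i3 - i2) ^ 2) =
      b powi ((i3 - j) ^ 2 + (i1 - i2) ^ 2)"
    using b(2) by (simp only: power_int_add simp_thms mult_1)
  then show ?thesis
    using b(2) by (simp only: power_int_add simp_thms)
qed

lemma W_nonsym_star:
  fixes a :: complex
  assumes a: "a ^ (2 * m ^ 2) = 1" "a \<noteq> 0" and j: "int m dvd j - (i1 + i2 - i3)"
  shows "a powi ((i1 - j) ^ 2 + int m * (i1 - j)) * a powi ((i2 - j) ^ 2 + int m * (i2 - j)) *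
      a powi ((i1 - i3) ^ 2 + int m * (i1 - i3)) * a powi ((i3 - i2) ^ 2 + int m * (i3 - i2)) =
    a powi ((i3 - j) ^ 2 + int m * (i3 - j)) * a powi ((i1 - i2) ^ 2 + int m * (i1 - i2))"
proof -
  let ?e = "\<lambda>d. d ^ 2 + int m * d"
  obtain k where "j - (i1 + i2 - i3) = int m * k" using j by blast
  then have jk: "j = i1 + i2 - i3 + int m * k" by simp
  \<comment> \<open>The linear terms turn the excess \<open>m ^ 2 * k ^ 2\<close> of the purely
    quadratic exponent into \<open>m ^ 2 * (k * (k - 1))\<close>, which is a multiple of
    \<open>2 * m ^ 2\<close>.\<close>
  have "even (k * (k - 1))" by simp
  then obtain q where q: "k * (k - 1) = 2 * q" by blast
  have "?e (i1 - j) + ?e (i2 - j) + ?e (i1 - i3) + ?e (i3 - i2) =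
      int (m ^ 2) * (k * (k - 1)) + (?e (i3 - j) + ?e (i1 - i2))"
    by (simp add: jk power2_eq_square algebra_simps)
  moreover have "a powi (int (m ^ 2) * (k * (k - 1))) = 1"
    using a(1) by (rule powi_eq_1) (simp add: q)
  ultimately have "a powi (?e (i1 - j) + ?e (i2 - j) + ?e (i1 - i3) + ?e (i3 - i2)) =
      a powi (?e (i3 - j) + ?e (i1 - i2))"
    using a(2) power_int_add[of a "int (m ^ 2) * (k * (k - 1))"] by simp
  moreover have add: "a powi (d + d') = a powi d * a powi d'" for d d'
    using a(2) by (simp add: power_int_add)
  ultimately show ?thesis
    by (simp only: add[of _ "?e (i3 - i2)"] add[of _ "?e (i1 - i3)"] add[of "?e (i1 - j)"]
        add[of "?e (i3 - j)"])
qed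

lemma W_nonsym_level_shift:
  assumes a: "a ^ (2 * m ^ 2) = 1" "a \<noteq> 0"
    and \<alpha>: "\<alpha> \<in> index_set m r"
  shows "W_nonsym m u H a \<beta> \<alpha> = W_nonsym m u H a (level_shift m r \<alpha>) \<beta>"
proof -
  obtain i l x where p: "\<alpha> = (i, l, x)" by (cases \<alpha>)
  obtain j l' y where q: "\<beta> = (j, l', y)" by (cases \<beta>)
  let ?e = "\<lambda>l. 2 * int m * (l - l') * (i - j) + ((i - j) ^ 2 + int m * (i - j))"
  define s where "s = (l - 1) mod int m"
  have "int m dvd s - (l - 1)" by (simp add: s_def mod_eq_dvd_iff[symmetric])
  then obtain k where "s - (l - 1) = int m * k" by blast
  then have s: "s = l - 1 + int m * k" by simp
  \<comment> \<open>Lowering \<open>l\<close> by one subtracts \<open>2 * m * (i - j)\<close> and so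
    reverses the sign of the linear term; reducing the level modulo \<open>m\<close> changes the
    exponent by a multiple of \<open>2 * m ^ 2\<close>.\<close>
  have "?e s = int (2 * m ^ 2) * (k * (i - j)) +
      (2 * int m * (l' - l) * (j - i) + ((j - i) ^ 2 + int m * (j - i)))"
    by (simp add: s power2_eq_square algebra_simps)
  moreover have "a powi (int (2 * m ^ 2) * (k * (i - j))) = 1"
    using a(1) by (rule powi_eq_1) simp
  ultimately have "a powi (2 * int m * (l' - l) * (j - i) + ((j - i) ^ 2 + int m * (j - i))) =
      a powi ?e s"
    using a(2) power_int_add[of a "int (2 * m ^ 2) * (k * (i - j))"] by simp
  then show ?thesis
    using \<alpha> by (simp add: p q W_nonsym_def level_shift_def s_def V_block_transpose[of u H j i])
qed

theorem theorem1p1: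
  fixes r m :: nat and u :: complex and H :: "nat \<Rightarrow> nat \<Rightarrow> complex"
  assumes "0 < r"
    and "0 < m" and "even m"
    and "2 \<le> r \<Longrightarrow> (u ^ 2 + inverse (u ^ 2)) ^ 2 = of_nat r"
    and "r = 1 \<Longrightarrow> u ^ 4 = 1"
    and "hadamard_matrix r H"
  shows "(\<forall>a. primitive_root_of_unity (2 * m ^ 2) a \<longrightarrow>
            spin_model (index_set m r) (W_nonsym m u H a) \<and>
            has_index (index_set m r) (W_nonsym m u H a) m) \<and>
         (\<forall>\<eta> b. primitive_root_of_unity m \<eta> \<and> b ^ (m ^ 2) = 1 \<longrightarrow>
            spin_model (index_set m r) (W_sym u H \<eta> b) \<and>
            symmetric_matrix (index_set m r) (W_sym u H \<eta> b))"
proof -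
  note H = \<open>hadamard_matrix r H\<close>
  have u0: "u \<noteq> 0"
  proof
    assume "u = 0"
    \<comment> \<open>Since \<open>inverse 0 = 0\<close>, the hypothesis for
      \<open>r \<ge> 2\<close> would read \<open>0 = r\<close>.\<close>
    then show False using assms(1,4,5) by (cases "r = 1") (auto simp: power_0_left)
  qed
  define D where "D = (if r = 1 then u ^ 2 else - (u ^ 2 + inverse (u ^ 2)))"
  interpret potts_parameters r u D
  proof
    show "D ^ 2 = of_nat r"
    proof (cases "r = 1")
      case True
      then show ?thesis using assms(5) by (simp add: D_def flip: power_mult)
    next
      case False
      then have "2 \<le> r" using assms(1) by simp
      then show ?thesis using assms(4) False by (simp only: D_def power2_minus if_False)
    qed
  qed (use assms u0 in \<open>auto simp: D_def\<close>)
  obtain d :: real where d: "D = complex_of_real d" "d \<noteq> 0" "d ^ 2 = real r"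
    by (rule D_real)
  have V0: "V_block u H i j x y \<noteq> 0" if "x \<in> {1..r}" "y \<in> {1..r}" for i j x y
    using V_block_nz[OF H that] .
  have II: "type_II (index_set m r) (W_twist \<omega> c (V_block u H))"
    if "primitive_root_of_unity m \<omega>" "\<And>i j. c i j \<noteq> 0" for \<omega> c
    using type_II_W_twist[OF that V0 V_block_type_II[OF H]] .
  have spin: "spin_model (index_set m r) (W_twist \<omega> c (V_block u H))"
    if "primitive_root_of_unity m \<omega>" "\<And>i j. c i j \<noteq> 0"
      "\<And>i1 i2 i3 j. int m dvd j - (i1 + i2 - i3) \<Longrightarrow>
        c i1 j * c i2 j * c i1 i3 * c i3 i2 = c i3 j * c i1 i2" for \<omega> c
  proof (rule spin_model_W_twist[OF that(1,2) V0 II[OF that(1,2)] d(2,3) that(3)])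
    fix i1 i2 i3 j x1 x2 x3
    assume "int m dvd j - (i1 + i2 - i3)" and I: "x1 \<in> {1..r}" "x2 \<in> {1..r}" "x3 \<in> {1..r}"
    \<comment> \<open>Evenness of \<open>m\<close> makes the parities of the block indices
      compatible with reduction modulo \<open>m\<close>.\<close>
    then have "even (j - (i1 + i2 - i3))"
      using \<open>even m\<close> by (meson dvd_trans even_of_nat)
    then show "(\<Sum>y\<in>{1..r}. V_block u H i1 j x1 y * V_block u H i2 j x2 y / V_block u H i3 j x3 y) =
        complex_of_real d * (V_block u H i1 i2 x1 x2 / (V_block u H i1 i3 x1 x3 * V_block u H i3 i2 x3 x2))"
      using V_block_star[OF H I] d(1) by simp
  qed
  show ?thesis
  proof (intro conjI allI impI; (elim conjE)?)
    fix a assume a: "primitive_root_of_unity (2 * m ^ 2) a"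
    have a1: "a ^ (2 * m ^ 2) = 1" and a0: "a \<noteq> 0"
      using a \<open>0 < m\<close> by (auto simp: primitive_root_of_unity_def power_0_left)
    have \<omega>: "primitive_root_of_unity m (a ^ (2 * m))"
      by (rule primitive_root_of_unity_power) (use a in \<open>simp add: power2_eq_square mult.assoc\<close>)
    note tw = W_nonsym_eq_W_twist[OF a0]
    show "spin_model (index_set m r) (W_nonsym m u H a)"
      unfolding tw
      by (rule spin[OF \<omega>]) (simp add: a0, rule W_nonsym_star[OF a1 a0], assumption)
    show "has_index (index_set m r) (W_nonsym m u H a) m"
    proof (rule has_indexI[OF _ _ level_shift_permutes])
      show "type_II (index_set m r) (W_nonsym m u H a)"
        unfolding tw by (rule II[OF \<omega>]) (simp add: a0)
      show "type_II (index_set m r) (mat_transpose (W_nonsym m u H a))"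
        unfolding tw mat_transpose_W_twist by (rule II[OF \<omega>]) (simp add: a0)
      show "perm_order (level_shift m r) = m"
        using assms by (simp add: perm_order_level_shift)
      show "W_nonsym m u H a \<beta> \<alpha> = W_nonsym m u H a (level_shift m r \<alpha>) \<beta>"
        if "\<alpha> \<in> index_set m r" for \<alpha> \<beta>
        using W_nonsym_level_shift[OF a1 a0 that] .
    qed
  next
    fix \<eta> b :: complex assume \<eta>: "primitive_root_of_unity m \<eta>" and b: "b ^ (m ^ 2) = 1"
    have b0: "b \<noteq> 0" using b \<open>0 < m\<close> by (auto simp: power_0_left)
    show "spin_model (index_set m r) (W_sym u H \<eta> b)"
      unfolding W_sym_eq_W_twist
      by (rule spin[OF \<eta>]) (simp add: b0, rule W_sym_star[OF b b0], assumption)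
    show "symmetric_matrix (index_set m r) (W_sym u H \<eta> b)"
      unfolding W_sym_eq_W_twist symmetric_matrix_def mat_transpose_W_twist
      by (simp add: power2_commute mat_eq_def)
  qed
qed

end
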